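(* Let $a_n = \tan\left(\frac{1}{n+1}\right)$ for all integers $n\ge 0$. Then the terraced matrix $M=M(a)$ generated by the sequence $a=\{a_n\}_{n\ge 0}$ is not a hyponormal operator on $\ell^2$.
   Context: $\ell^2$ denotes the Hilbert space of square-summable complex sequences indexed by the nonnegative integers. For a sequence $a=\{a_n\}_{n\ge 0}$ of complex numbers, the terraced matrix $M(a)$ generated by $a$ is the lower triangular infinite matrix with constant row segments, i.e. the matrix with entries $m_{nj}=a_n$ for $0\le j\le n$ and $m_{nj}=0$ for $j>n$ ($n,j\ge 0$); it acts on $\ell^2$ by matrix multiplication, $(Mf)_n = a_n\sum_{j=0}^n f_j$. The standing assumption is that $M(a)$ acts as a bounded linear operator on $\ell^2$ (this is the case for the sequence in the claim). A bounded linear operator $M$ on $\ell^2$ is hyponormal if $\langle (M^*M-MM^* )f,f\rangle\ge 0$ for all $f\in\ell^2$; the claim is that the bounded operator $M$ fails this condition. *)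

theory Defs
  imports "HOL-Analysis.Analysis"
begin

text \<open>
  Operators on the sequence space are total functions on all complex sequences; only their
  values on \<^term>\<open>ell2\<close> matter. The inner product is linear in its first argument.
\<close>

definition ell2 :: "(nat \<Rightarrow> complex) set" where
  "ell2 = {f. summable (\<lambda>n. (cmod (f n))\<^sup>2)}"

definition ell2_inner :: "(nat \<Rightarrow> complex) \<Rightarrow> (nat \<Rightarrow> complex) \<Rightarrow> complex" where
  "ell2_inner f g = (\<Sum>n. f n * cnj (g n))"

definition ell2_norm :: "(nat \<Rightarrow> complex) \<Rightarrow> real" where
  "ell2_norm f = sqrt (\<Sum>n. (cmod (f n))\<^sup>2)"

definition bounded_operator_ell2 :: "((nat \<Rightarrow> complex) \<Rightarrow> (nat \<Rightarrow> complex)) \<Rightarrow> bool" where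
  "bounded_operator_ell2 T \<longleftrightarrow>
     (\<forall>f\<in>ell2. T f \<in> ell2) \<and>
     (\<forall>f\<in>ell2. \<forall>g\<in>ell2. T (\<lambda>n. f n + g n) = (\<lambda>n. T f n + T g n)) \<and>
     (\<forall>c. \<forall>f\<in>ell2. T (\<lambda>n. c * f n) = (\<lambda>n. c * T f n)) \<and>
     (\<exists>K. \<forall>f\<in>ell2. ell2_norm (T f) \<le> K * ell2_norm f)"

text \<open>
  For a bounded operator such an \<open>S\<close> exists by the Riesz representation theorem, and its
  values on \<^term>\<open>ell2\<close> are uniquely determined.
\<close>

definition ell2_adjoint ::
  "((nat \<Rightarrow> complex) \<Rightarrow> (nat \<Rightarrow> complex)) \<Rightarrow> (nat \<Rightarrow> complex) \<Rightarrow> (nat \<Rightarrow> complex)" where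
  "ell2_adjoint T =
     (SOME S. (\<forall>g\<in>ell2. S g \<in> ell2) \<and>
        (\<forall>f\<in>ell2. \<forall>g\<in>ell2. ell2_inner (T f) g = ell2_inner f (S g)))"

definition hyponormal_ell2 :: "((nat \<Rightarrow> complex) \<Rightarrow> (nat \<Rightarrow> complex)) \<Rightarrow> bool" where
  "hyponormal_ell2 T \<longleftrightarrow>
     bounded_operator_ell2 T \<and>
     (\<forall>f\<in>ell2.
        ell2_inner (\<lambda>n. ell2_adjoint T (T f) n - T (ell2_adjoint T f) n) f \<in> \<real>\<^sub>\<ge>\<^sub>0)"

definition terraced_matrix :: "(nat \<Rightarrow> complex) \<Rightarrow> nat \<Rightarrow> nat \<Rightarrow> complex" where
  "terraced_matrix a n j = (if j \<le> n then a n else 0)"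

definition matrix_operator ::
  "(nat \<Rightarrow> nat \<Rightarrow> complex) \<Rightarrow> (nat \<Rightarrow> complex) \<Rightarrow> (nat \<Rightarrow> complex)" where
  "matrix_operator m f = (\<lambda>n. \<Sum>j. m n j * f j)"

lemma matrix_operator_terraced:
  "matrix_operator (terraced_matrix a) f n = a n * (\<Sum>j\<le>n. f j)"
proof -
  have "matrix_operator (terraced_matrix a) f n = (\<Sum>j\<le>n. terraced_matrix a n j * f j)"
    unfolding matrix_operator_def
    by (rule suminf_finite) (auto simp: terraced_matrix_def)
  also have "\<dots> = a n * (\<Sum>j\<le>n. f j)"
    by (simp add: terraced_matrix_def sum_distrib_left)
  finally show ?thesis .
qed

end

theory Submission
  imports Defs
begin

text \<open>
  A hyponormal operator satisfies \<open>\<parallel>M\<^sup>* f\<parallel> \<le> \<parallel>M f\<parallel>\<close> for all \<open>f\<close>, so a single vector that violates this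
  inequality refutes hyponormality. For a vector supported on the first seven coordinates,
  \<open>M\<^sup>* f\<close> is a finite vector as well, with entries \<open>\<Sum>\<^sub>n\<^sub>\<ge>\<^sub>j a\<^sub>n f\<^sub>n\<close>, and only \<open>M f\<close> has an infinite tail:
  it is \<open>a\<^sub>n\<close> times the constant \<open>F = \<Sum>f\<^sub>j\<close> from the last nonzero coordinate on. The vector
  \<open>(1, 1, 1, 0, 1, 1, 4)\<close> works: \<open>\<parallel>M f\<parallel>\<^sup>2\<close> is about 19.15 and \<open>\<parallel>M\<^sup>* f\<parallel>\<^sup>2\<close> about 19.26
  (\<open>test_vector_norm_less_adjoint_norm\<close>). It was found by a numerical search
  for a large ratio \<open>\<parallel>M\<^sup>* f\<parallel> / \<parallel>M f\<parallel>\<close> among small nonnegative integer vectors.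

  The gap is about half a percent, so the estimates must be fairly sharp. Since the vector is
  nonnegative, both norms increase with every \<open>a\<^sub>n\<close>; rational enclosures of \<open>tan (1/m)\<close> for
  \<open>m \<le> 7\<close>, obtained from Taylor polynomials of sine and cosine, can therefore be inserted
  directly. The tail is summed through \<open>tan\<^sup>2 (1/m) \<le> 1/(m\<^sup>2 - 1)\<close>, which follows from
  \<open>sin x \<le> x\<close>, telescopes, and exceeds the true value only by a term of order \<open>1/m\<^sup>4\<close>
  (\<open>tan_inverse_square_tail\<close>).

  The functional analysis rests on \<open>0 \<le> a\<^sub>n \<le> 2/(n + 1)\<close> alone. Hardy's inequality
  (\<open>hardy_finite\<close>) gives boundedness. Since the adjoint is given by a choice operator, its
  values become accessible only once some adjoint is exhibited; this is the transposed matrix,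
  which maps the sequence space to itself by the dual of Hardy's inequality
  (\<open>dual_hardy_finite\<close>) and satisfies the adjoint identity by Fubini's theorem
  (\<open>terraced_adjoint_inner\<close>).
\<close>

section \<open>Square-summable sequences and adjoints\<close>

lemma ell2_summable_norm_mult:
  assumes "f \<in> ell2" "g \<in> ell2"
  shows "summable (\<lambda>n. cmod (f n) * cmod (g n))"
proof (rule summable_comparison_test')
  show "summable (\<lambda>n. (cmod (f n))\<^sup>2 + (cmod (g n))\<^sup>2)"
    using assms unfolding ell2_def by (intro summable_add) auto
  show "norm (cmod (f n) * cmod (g n)) \<le> (cmod (f n))\<^sup>2 + (cmod (g n))\<^sup>2" if "n \<ge> 0" for n
  proof -
    have "2 * (cmod (f n) * cmod (g n)) \<le> (cmod (f n))\<^sup>2 + (cmod (g n))\<^sup>2"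
      using sum_squares_bound[of "cmod (f n)" "cmod (g n)"] by (simp add: mult.assoc)
    moreover have "0 \<le> cmod (f n) * cmod (g n)" by simp
    ultimately have "cmod (f n) * cmod (g n) \<le> (cmod (f n))\<^sup>2 + (cmod (g n))\<^sup>2" by linarith
    then show ?thesis by simp
  qed
qed

lemma ell2_summable_inner:
  assumes "f \<in> ell2" "g \<in> ell2"
  shows "summable (\<lambda>n. f n * cnj (g n))"
  using ell2_summable_norm_mult[OF assms]
  by (intro summable_norm_cancel[of "\<lambda>n. f n * cnj (g n)"]) (simp add: norm_mult)

lemma ell2_inner_self:
  assumes "f \<in> ell2"
  shows "ell2_inner f f = complex_of_real (\<Sum>n. (cmod (f n))\<^sup>2)"
  using assms suminf_of_real[of "\<lambda>n. (cmod (f n))\<^sup>2", where 'a = complex]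
  unfolding ell2_inner_def ell2_def by (simp only: complex_norm_square mem_Collect_eq)

lemma cnj_ell2_inner:
  assumes "f \<in> ell2" "g \<in> ell2"
  shows "cnj (ell2_inner f g) = ell2_inner g f"
proof -
  have "(\<lambda>n. cnj (f n * cnj (g n))) sums cnj (ell2_inner f g)"
    unfolding ell2_inner_def
    using ell2_summable_inner[OF assms] by (simp only: sums_cnj summable_sums)
  then show ?thesis
    unfolding ell2_inner_def by (simp add: sums_iff mult.commute)
qed

lemma ell2_finite_support:
  assumes "\<And>n. n \<ge> N \<Longrightarrow> f n = 0"
  shows "f \<in> ell2"
  unfolding ell2_def mem_Collect_eq
  by (rule summable_finite[of "{..<N}"]) (use assms in \<open>auto simp: not_less\<close>)

text \<open>
  Pairing with the unit vectors shows that the adjoint identity determines every coordinate of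
  the adjoint, so the choice in \<^const>\<open>ell2_adjoint\<close> agrees with any candidate \<open>S\<close>.
\<close>

lemma ell2_adjoint_eqI:
  assumes S: "\<And>g. g \<in> ell2 \<Longrightarrow> S g \<in> ell2"
    and adj: "\<And>f g. f \<in> ell2 \<Longrightarrow> g \<in> ell2 \<Longrightarrow> ell2_inner (T f) g = ell2_inner f (S g)"
    and g: "g \<in> ell2"
  shows "ell2_adjoint T g = S g"
proof
  fix j
  have spec: "(\<forall>g\<in>ell2. ell2_adjoint T g \<in> ell2) \<and>
      (\<forall>f\<in>ell2. \<forall>g\<in>ell2. ell2_inner (T f) g = ell2_inner f (ell2_adjoint T g))"
    unfolding ell2_adjoint_def by (rule someI[of _ S]) (use S adj in auto)
  define e :: "nat \<Rightarrow> complex" where "e n = (if n = j then 1 else 0)" for n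
  have e: "e \<in> ell2"
    by (rule ell2_finite_support[of "Suc j"]) (auto simp: e_def)
  have coord: "ell2_inner e h = cnj (h j)" for h
  proof -
    have "ell2_inner e h = (\<Sum>n\<in>{j}. e n * cnj (h n))"
      unfolding ell2_inner_def by (rule suminf_finite) (auto simp: e_def)
    then show ?thesis by (simp add: e_def)
  qed
  have "ell2_inner e (ell2_adjoint T g) = ell2_inner e (S g)"
    using spec adj e g by metis
  then show "ell2_adjoint T g j = S g j"
    by (simp add: coord)
qed

text \<open>
  Moving operators across the inner product turns \<open>\<langle>(T\<^sup>* T - T T\<^sup>*) f, f\<rangle>\<close> into
  \<open>\<parallel>T f\<parallel>\<^sup>2 - \<parallel>T\<^sup>* f\<parallel>\<^sup>2\<close>.
\<close>

lemma hyponormal_imp_adjoint_norm_le: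
  assumes hyp: "hyponormal_ell2 T"
    and S: "\<And>g. g \<in> ell2 \<Longrightarrow> S g \<in> ell2"
    and adj: "\<And>f g. f \<in> ell2 \<Longrightarrow> g \<in> ell2 \<Longrightarrow> ell2_inner (T f) g = ell2_inner f (S g)"
    and f: "f \<in> ell2"
  shows "(\<Sum>n. (cmod (S f n))\<^sup>2) \<le> (\<Sum>n. (cmod (T f n))\<^sup>2)"
proof -
  have T: "T h \<in> ell2" if "h \<in> ell2" for h
    using hyp that unfolding hyponormal_ell2_def bounded_operator_ell2_def by blast
  have "ell2_inner (S (T f)) f = cnj (ell2_inner f (S (T f)))"
    by (simp add: cnj_ell2_inner f S T)
  also have "\<dots> = ell2_inner (T f) (T f)"
    by (simp add: adj[symmetric] cnj_ell2_inner f T)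
  finally have TT: "ell2_inner (S (T f)) f = ell2_inner (T f) (T f)" .
  have SS: "ell2_inner (T (S f)) f = ell2_inner (S f) (S f)"
    by (simp add: adj f S)
  have "ell2_inner (\<lambda>n. S (T f) n - T (S f) n) f = ell2_inner (S (T f)) f - ell2_inner (T (S f)) f"
    unfolding ell2_inner_def left_diff_distrib
    by (rule suminf_diff[symmetric]) (simp_all add: ell2_summable_inner f S T)
  also have "\<dots> = complex_of_real ((\<Sum>n. (cmod (T f n))\<^sup>2) - (\<Sum>n. (cmod (S f n))\<^sup>2))"
    by (simp add: TT SS ell2_inner_self f S T)
  finally have inner: "ell2_inner (\<lambda>n. S (T f) n - T (S f) n) f
    = complex_of_real ((\<Sum>n. (cmod (T f n))\<^sup>2) - (\<Sum>n. (cmod (S f n))\<^sup>2))" .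
  have "ell2_inner (\<lambda>n. S (T f) n - T (S f) n) f \<in> \<real>\<^sub>\<ge>\<^sub>0"
    using hyp f unfolding hyponormal_ell2_def
    by (simp add: ell2_adjoint_eqI[OF S adj] T)
  then have "complex_of_real ((\<Sum>n. (cmod (T f n))\<^sup>2) - (\<Sum>n. (cmod (S f n))\<^sup>2)) \<in> \<real>\<^sub>\<ge>\<^sub>0"
    by (simp only: inner)
  then show ?thesis
    by (simp only: nonneg_Reals_of_real_iff)
qed

section \<open>Hardy's inequality\<close>

text \<open>
  Elliott's proof. With \<open>A\<^sub>n\<close> the average of \<open>f\<^sub>0, \<dots>, f\<^sub>n\<close>, the differences \<open>A\<^sub>n\<^sup>2 - 2 A\<^sub>n f\<^sub>n\<close> are bounded by
  a telescoping sequence, which gives \<open>\<Sum>A\<^sub>n\<^sup>2 \<le> 2 \<Sum>A\<^sub>n f\<^sub>n\<close>; the mixed term is then absorbed into the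
  left-hand side by the inequality of arithmetic and geometric means.
\<close>

lemma hardy_finite:
  fixes f :: "nat \<Rightarrow> real"
  shows "(\<Sum>n<N. ((\<Sum>j\<le>n. f j) / real (Suc n))\<^sup>2) \<le> 4 * (\<Sum>n<N. (f n)\<^sup>2)"
proof -
  define A where "A n = (\<Sum>j\<le>n. f j) / real (Suc n)" for n
  \<comment> \<open>For \<open>N = 0\<close> the quotient is \<open>0 / 0 = 0\<close>, so the induction starts correctly.\<close>
  have tele: "(\<Sum>n<N. (A n)\<^sup>2 - 2 * A n * f n) + (\<Sum>j<N. f j)\<^sup>2 / real N \<le> 0" for N
  proof (induction N)
    case 0
    then show ?case by simp
  next
    case (Suc N)
    define F where "F = (\<Sum>j<N. f j)"
    have FS: "(\<Sum>j<Suc N. f j) = real (Suc N) * A N"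
      unfolding A_def by (simp add: lessThan_Suc_atMost del: of_nat_Suc)
    have x: "f N = real (Suc N) * A N - F"
      using FS by (simp add: F_def)
    \<comment> \<open>Completing the square: this is \<open>(F - N A\<^sub>N)\<^sup>2 \<ge> 0\<close> divided by \<open>N\<close>.\<close>
    have step: "2 * A N * F - real N * (A N)\<^sup>2 \<le> F\<^sup>2 / real N"
    proof (cases "N = 0")
      case False
      have "0 \<le> (F - real N * A N)\<^sup>2" by simp
      then show ?thesis
        using False by (simp add: field_simps power2_eq_square)
    qed (simp add: F_def)
    have "(\<Sum>j<Suc N. f j)\<^sup>2 / real (Suc N) = real (Suc N) * (A N)\<^sup>2"
      by (simp only: FS) (simp add: power2_eq_square del: of_nat_Suc)
    moreover have "(A N)\<^sup>2 - 2 * A N * f N + real (Suc N) * (A N)\<^sup>2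
        = 2 * A N * F - real N * (A N)\<^sup>2"
      unfolding x by (simp add: algebra_simps power2_eq_square)
    ultimately show ?case
      using Suc.IH step by (simp add: F_def del: of_nat_Suc)
  qed
  have "0 \<le> (\<Sum>j<N. f j)\<^sup>2 / real N" by simp
  with tele[of N] have "(\<Sum>n<N. (A n)\<^sup>2) \<le> (\<Sum>n<N. 2 * A n * f n)"
    by (simp only: sum_subtractf)
  also have "\<dots> \<le> (\<Sum>n<N. (A n)\<^sup>2 / 2 + 2 * (f n)\<^sup>2)"
  proof (rule sum_mono)
    fix n
    have "0 \<le> (A n - 2 * f n)\<^sup>2" by simp
    then show "2 * A n * f n \<le> (A n)\<^sup>2 / 2 + 2 * (f n)\<^sup>2"
      by (simp add: power2_eq_square algebra_simps)
  qed
  also have "\<dots> = (\<Sum>n<N. (A n)\<^sup>2) / 2 + 2 * (\<Sum>n<N. (f n)\<^sup>2)"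
    by (simp add: sum.distrib sum_divide_distrib sum_distrib_left)
  finally show ?thesis by (simp add: A_def)
qed

lemma hardy_weighted:
  fixes f w :: "nat \<Rightarrow> real"
  assumes "\<And>n. \<bar>w n\<bar> \<le> C / real (Suc n)"
  shows "(\<Sum>n<N. (w n * (\<Sum>j\<le>n. f j))\<^sup>2) \<le> 4 * C\<^sup>2 * (\<Sum>n<N. (f n)\<^sup>2)"
proof -
  have "(\<Sum>n<N. (w n * (\<Sum>j\<le>n. f j))\<^sup>2)
      \<le> (\<Sum>n<N. C\<^sup>2 * ((\<Sum>j\<le>n. f j) / real (Suc n))\<^sup>2)"
  proof (rule sum_mono)
    fix n
    have "(w n)\<^sup>2 \<le> (C / real (Suc n))\<^sup>2"
      using power_mono[OF assms[of n], of 2] by simp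
    then have "(w n)\<^sup>2 * (\<Sum>j\<le>n. f j)\<^sup>2 \<le> (C / real (Suc n))\<^sup>2 * (\<Sum>j\<le>n. f j)\<^sup>2"
      by (rule mult_right_mono) simp
    then show "(w n * (\<Sum>j\<le>n. f j))\<^sup>2 \<le> C\<^sup>2 * ((\<Sum>j\<le>n. f j) / real (Suc n))\<^sup>2"
      by (simp add: power_mult_distrib power_divide)
  qed
  also have "\<dots> \<le> C\<^sup>2 * (4 * (\<Sum>n<N. (f n)\<^sup>2))"
    unfolding sum_distrib_left[symmetric] by (rule mult_left_mono[OF hardy_finite]) simp
  finally show ?thesis by (simp add: mult_ac)
qed

section \<open>Terraced operators with entries of order 1/n\<close>

lemma terraced_partial_sums_le:
  assumes a: "\<And>n. cmod (a n) \<le> C / real (Suc n)" and f: "f \<in> ell2"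
  shows "(\<Sum>n<N. (cmod (matrix_operator (terraced_matrix a) f n))\<^sup>2)
           \<le> 4 * C\<^sup>2 * (\<Sum>n. (cmod (f n))\<^sup>2)"
proof -
  have "(\<Sum>n<N. (cmod (matrix_operator (terraced_matrix a) f n))\<^sup>2)
      \<le> (\<Sum>n<N. (cmod (a n) * (\<Sum>j\<le>n. cmod (f j)))\<^sup>2)"
    unfolding matrix_operator_terraced norm_mult
    by (intro sum_mono power_mono mult_left_mono norm_sum) auto
  also have "\<dots> \<le> 4 * C\<^sup>2 * (\<Sum>n<N. (cmod (f n))\<^sup>2)"
    by (rule hardy_weighted) (use a in simp)
  also have "\<dots> \<le> 4 * C\<^sup>2 * (\<Sum>n. (cmod (f n))\<^sup>2)"
    using f unfolding ell2_def by (intro mult_left_mono sum_le_suminf) auto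
  finally show ?thesis .
qed

lemma terraced_ell2:
  assumes "\<And>n. cmod (a n) \<le> C / real (Suc n)" and "f \<in> ell2"
  shows "matrix_operator (terraced_matrix a) f \<in> ell2"
  unfolding ell2_def mem_Collect_eq
  by (rule bounded_imp_summable[OF _ terraced_partial_sums_le[OF assms, of "Suc _", unfolded lessThan_Suc_atMost]])
     simp

lemma terraced_bounded:
  assumes a: "\<And>n. cmod (a n) \<le> C / real (Suc n)"
  shows "bounded_operator_ell2 (matrix_operator (terraced_matrix a))"
proof -
  let ?T = "matrix_operator (terraced_matrix a)"
  have C: "0 \<le> C"
    using order_trans[OF norm_ge_zero a[of 0]] by simp
  have norm: "ell2_norm (?T f) \<le> 2 * C * ell2_norm f" if f: "f \<in> ell2" for f
  proof -
    have "(\<Sum>n. (cmod (?T f n))\<^sup>2) \<le> 4 * C\<^sup>2 * (\<Sum>n. (cmod (f n))\<^sup>2)"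
      using terraced_ell2[OF a f] terraced_partial_sums_le[OF a f] unfolding ell2_def
      by (intro suminf_le_const) auto
    then have "ell2_norm (?T f) \<le> sqrt (4 * C\<^sup>2 * (\<Sum>n. (cmod (f n))\<^sup>2))"
      unfolding ell2_norm_def by (rule real_sqrt_le_mono)
    also have "\<dots> = 2 * C * ell2_norm f"
      using C by (simp add: ell2_norm_def real_sqrt_mult)
    finally show ?thesis .
  qed
  show ?thesis
    unfolding bounded_operator_ell2_def
  proof (intro conjI ballI allI)
    show "?T f \<in> ell2" if "f \<in> ell2" for f
      using terraced_ell2[OF a that] .
    show "?T (\<lambda>n. f n + g n) = (\<lambda>n. ?T f n + ?T g n)" for f g
      by (simp add: fun_eq_iff matrix_operator_terraced sum.distrib ring_distribs)
    show "?T (\<lambda>n. c * f n) = (\<lambda>n. c * ?T f n)" for c f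
      by (simp add: fun_eq_iff matrix_operator_terraced sum_distrib_left mult_ac)
    show "\<exists>K. \<forall>f\<in>ell2. ell2_norm (?T f) \<le> K * ell2_norm f"
      using norm by blast
  qed
qed

text \<open>
  The conjugate transpose of the terraced matrix. Its rows are infinite, so the series needs a
  convergence argument, unlike the finite sums of the terraced operator itself.
\<close>

definition terraced_adjoint :: "(nat \<Rightarrow> complex) \<Rightarrow> (nat \<Rightarrow> complex) \<Rightarrow> (nat \<Rightarrow> complex)" where
  "terraced_adjoint a g = (\<lambda>j. \<Sum>n. if j \<le> n then cnj (a n) * g n else 0)"

lemma ell2_of_order_inverse:
  assumes a: "\<And>n. cmod (a n) \<le> C / real (Suc n)"
  shows "a \<in> ell2"
  unfolding ell2_def mem_Collect_eq
proof (rule summable_comparison_test')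
  show "summable (\<lambda>n. C\<^sup>2 * (1 / real (Suc n) ^ 2))"
    by (intro summable_mult) (use inverse_power_summable[of 2, where 'a = real] in
        \<open>simp add: summable_Suc_iff[of "\<lambda>n. 1 / real n ^ 2"] inverse_eq_divide del: of_nat_Suc\<close>)
  show "norm ((cmod (a n))\<^sup>2) \<le> C\<^sup>2 * (1 / real (Suc n) ^ 2)" if "n \<ge> 0" for n
    using power_mono[OF a[of n], of 2] by (simp add: power_divide del: of_nat_Suc)
qed

lemma terraced_adjoint_norm_summable:
  assumes a: "\<And>n. cmod (a n) \<le> C / real (Suc n)" and g: "g \<in> ell2"
  shows "summable (\<lambda>n. cmod (if j \<le> n then cnj (a n) * g n else 0))"
  by (rule summable_comparison_test'[OF ell2_summable_norm_mult[OF ell2_of_order_inverse[OF a] g]])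
     (auto simp: norm_mult)

text \<open>
  Duality: writing \<open>s\<close> for the sequence on the left, the square sum \<open>Q\<close> of \<open>s\<close> is the pairing of \<open>g\<close>
  with the weighted partial sums of \<open>s\<close>. The Cauchy-Schwarz inequality and Hardy's inequality
  for \<open>s\<close> bound \<open>Q\<^sup>2\<close> by a multiple of \<open>Q\<close>, and \<open>Q\<close> cancels.
\<close>

lemma dual_hardy_finite:
  fixes w g :: "nat \<Rightarrow> real"
  assumes w: "\<And>n. \<bar>w n\<bar> \<le> C / real (Suc n)"
  shows "(\<Sum>j<N. (\<Sum>n<N. if j \<le> n then w n * g n else 0)\<^sup>2) \<le> 4 * C\<^sup>2 * (\<Sum>n<N. (g n)\<^sup>2)"
proof -
  define s where "s j = (\<Sum>n<N. if j \<le> n then w n * g n else 0)" for j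
  define Q where "Q = (\<Sum>j<N. (s j)\<^sup>2)"
  have "Q = (\<Sum>j<N. \<Sum>n<N. if j \<le> n then g n * (w n * s j) else 0)"
  proof -
    have "(s j)\<^sup>2 = (\<Sum>n<N. if j \<le> n then g n * (w n * s j) else 0)" for j
    proof -
      have "(s j)\<^sup>2 = s j * (\<Sum>n<N. if j \<le> n then w n * g n else 0)"
        by (simp add: s_def power2_eq_square)
      then show ?thesis
        by (simp add: sum_distrib_left if_distrib mult_ac cong: if_cong)
    qed
    then show ?thesis by (simp add: Q_def)
  qed
  also have "\<dots> = (\<Sum>n<N. \<Sum>j<N. if j \<le> n then g n * (w n * s j) else 0)"
    by (rule sum.swap)
  also have "\<dots> = (\<Sum>n<N. g n * (w n * (\<Sum>j\<le>n. s j)))"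
  proof (rule sum.cong[OF refl])
    fix n assume n: "n \<in> {..<N}"
    have "(\<Sum>j<N. if j \<le> n then g n * (w n * s j) else 0) = (\<Sum>j\<le>n. g n * (w n * s j))"
      by (rule sum.mono_neutral_cong_right) (use n in auto)
    then show "(\<Sum>j<N. if j \<le> n then g n * (w n * s j) else 0) = g n * (w n * (\<Sum>j\<le>n. s j))"
      by (simp add: sum_distrib_left)
  qed
  finally have "Q\<^sup>2 = (\<Sum>n<N. g n * (w n * (\<Sum>j\<le>n. s j)))\<^sup>2" by simp
  also have "\<dots> \<le> (\<Sum>n<N. (g n)\<^sup>2) * (\<Sum>n<N. (w n * (\<Sum>j\<le>n. s j))\<^sup>2)"
    by (rule Cauchy_Schwarz_ineq_sum)
  also have "\<dots> \<le> (\<Sum>n<N. (g n)\<^sup>2) * (4 * C\<^sup>2 * Q)"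
    unfolding Q_def by (intro mult_left_mono hardy_weighted w sum_nonneg) auto
  finally have QQ: "Q * Q \<le> (4 * C\<^sup>2 * (\<Sum>n<N. (g n)\<^sup>2)) * Q"
    by (simp add: power2_eq_square mult_ac)
  have nonneg: "0 \<le> Q" "0 \<le> 4 * C\<^sup>2 * (\<Sum>n<N. (g n)\<^sup>2)"
    by (auto simp: Q_def intro!: sum_nonneg mult_nonneg_nonneg)
  have "Q \<le> 4 * C\<^sup>2 * (\<Sum>n<N. (g n)\<^sup>2)"
    using QQ nonneg by (cases "Q = 0") (auto dest: mult_right_le_imp_le)
  then show ?thesis by (simp add: Q_def s_def)
qed

text \<open>
  Truncating the rows at \<open>N\<close> makes the finite inequality applicable with a bound independent of
  \<open>N\<close>, which survives the limit for each fixed number \<open>J\<close> of coordinates.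
\<close>

lemma terraced_adjoint_ell2:
  assumes a: "\<And>n. cmod (a n) \<le> C / real (Suc n)" and g: "g \<in> ell2"
  shows "terraced_adjoint a g \<in> ell2"
proof -
  let ?K = "4 * C\<^sup>2 * (\<Sum>n. (cmod (g n))\<^sup>2)"
  define p where "p N j = (\<Sum>n<N. if j \<le> n then cnj (a n) * g n else 0)" for N j
  have p: "(\<lambda>N. p N j) \<longlonglongrightarrow> terraced_adjoint a g j" for j
    unfolding p_def terraced_adjoint_def
    by (rule summable_LIMSEQ[OF summable_norm_cancel[OF terraced_adjoint_norm_summable[OF a g]]])
  have bound: "(\<Sum>j<J. (cmod (p N j))\<^sup>2) \<le> ?K" if "J \<le> N" for J N
  proof -
    have "(\<Sum>j<J. (cmod (p N j))\<^sup>2) \<le> (\<Sum>j<N. (cmod (p N j))\<^sup>2)"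
      by (rule sum_mono2) (use that in auto)
    also have "\<dots> \<le> (\<Sum>j<N. (\<Sum>n<N. if j \<le> n then cmod (a n) * cmod (g n) else 0)\<^sup>2)"
    proof (intro sum_mono power_mono norm_ge_zero)
      fix j
      have "cmod (p N j) \<le> (\<Sum>n<N. cmod (if j \<le> n then cnj (a n) * g n else 0))"
        unfolding p_def by (rule norm_sum)
      also have "\<dots> = (\<Sum>n<N. if j \<le> n then cmod (a n) * cmod (g n) else 0)"
        by (intro sum.cong refl) (simp add: norm_mult)
      finally show "cmod (p N j) \<le> \<dots>" .
    qed
    also have "\<dots> \<le> 4 * C\<^sup>2 * (\<Sum>n<N. (cmod (g n))\<^sup>2)"
      by (rule dual_hardy_finite) (use a in simp)
    also have "\<dots> \<le> ?K"
      using g unfolding ell2_def by (intro mult_left_mono sum_le_suminf) auto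
    finally show ?thesis .
  qed
  have partial: "(\<Sum>j<J. (cmod (terraced_adjoint a g j))\<^sup>2) \<le> ?K" for J
  proof (rule LIMSEQ_le_const2)
    show "(\<lambda>N. \<Sum>j<J. (cmod (p N j))\<^sup>2) \<longlonglongrightarrow> (\<Sum>j<J. (cmod (terraced_adjoint a g j))\<^sup>2)"
      by (intro tendsto_intros p)
    show "\<exists>N. \<forall>n\<ge>N. (\<Sum>j<J. (cmod (p n j))\<^sup>2) \<le> ?K"
      using bound by blast
  qed
  show ?thesis
    unfolding ell2_def mem_Collect_eq
    by (rule bounded_imp_summable[OF _ partial[of "Suc _", unfolded lessThan_Suc_atMost]]) simp
qed

lemma suminf_eq_infsum:
  fixes f :: "nat \<Rightarrow> 'a :: banach"
  assumes "summable (\<lambda>n. norm (f n))"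
  shows "suminf f = infsum f UNIV"
  using norm_summable_imp_has_sum[OF assms summable_sums[OF summable_norm_cancel[OF assms]]]
  by (simp add: infsumI)

lemma infsum_finite_support:
  fixes f :: "'b \<Rightarrow> 'a :: {comm_monoid_add, t2_space}"
  assumes "finite A" and "\<And>x. x \<notin> A \<Longrightarrow> f x = 0"
  shows "f summable_on UNIV" and "infsum f UNIV = sum f A"
  using has_sum_cong_neutral[of UNIV A f f "sum f A"] has_sum_finite[OF assms(1), of f] assms(2)
  by (auto simp: summable_on_def infsumI)

text \<open>
  Both sides are iterated sums of the same array \<open>\<phi>\<close>, and the interchange is Fubini's theorem.
  Absolute summability of \<open>\<phi>\<close> holds because replacing \<open>a\<close>, \<open>f\<close> and \<open>g\<close> by their moduli keeps the
  terraced image of \<open>f\<close> square-summable.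
\<close>

lemma terraced_adjoint_inner:
  assumes a: "\<And>n. cmod (a n) \<le> C / real (Suc n)" and f: "f \<in> ell2" and g: "g \<in> ell2"
  shows "ell2_inner (matrix_operator (terraced_matrix a) f) g = ell2_inner f (terraced_adjoint a g)"
proof -
  let ?T = "matrix_operator (terraced_matrix a)"
  define \<phi> where "\<phi> n j = (if j \<le> n then a n * f j * cnj (g n) else 0)" for n j
  have row: "infsum (\<phi> n) UNIV = ?T f n * cnj (g n)" for n
  proof -
    have "infsum (\<phi> n) UNIV = (\<Sum>j\<le>n. \<phi> n j)"
      by (rule infsum_finite_support) (auto simp: \<phi>_def)
    then show ?thesis
      by (simp add: \<phi>_def matrix_operator_terraced sum_distrib_left sum_distrib_right)
  qed
  have row_abs: "(\<lambda>j. cmod (\<phi> n j)) summable_on UNIV"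
    "infsum (\<lambda>j. cmod (\<phi> n j)) UNIV = cmod (a n) * (\<Sum>j\<le>n. cmod (f j)) * cmod (g n)" for n
  proof -
    show "(\<lambda>j. cmod (\<phi> n j)) summable_on UNIV"
      by (rule infsum_finite_support[of "{..n}"]) (auto simp: \<phi>_def)
    have "infsum (\<lambda>j. cmod (\<phi> n j)) UNIV = (\<Sum>j\<le>n. cmod (\<phi> n j))"
      by (rule infsum_finite_support) (auto simp: \<phi>_def)
    then show "infsum (\<lambda>j. cmod (\<phi> n j)) UNIV = cmod (a n) * (\<Sum>j\<le>n. cmod (f j)) * cmod (g n)"
      by (simp add: \<phi>_def norm_mult sum_distrib_left sum_distrib_right)
  qed
  have total: "summable (\<lambda>n. cmod (a n) * (\<Sum>j\<le>n. cmod (f j)) * cmod (g n))"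
  proof -
    let ?h = "matrix_operator (terraced_matrix (\<lambda>n. complex_of_real (cmod (a n))))
      (\<lambda>j. complex_of_real (cmod (f j)))"
    have "?h \<in> ell2"
      by (rule terraced_ell2[where C = C]) (use a f in \<open>simp_all add: ell2_def\<close>)
    moreover have "cmod (?h n) = cmod (a n) * (\<Sum>j\<le>n. cmod (f j))" for n
      by (simp add: matrix_operator_terraced norm_mult sum_nonneg flip: of_real_sum)
    ultimately show ?thesis
      using ell2_summable_norm_mult[of ?h g] g by simp
  qed
  have "(\<lambda>p. norm ((\<lambda>(n, j). \<phi> n j) p)) summable_on UNIV \<times> UNIV"
    unfolding Infinite_Sum.abs_summable_on_Sigma_iff using row_abs total
    by (auto intro!: norm_summable_imp_summable_on simp: sum_nonneg)
  then have swap: "infsum (\<lambda>n. infsum (\<phi> n) UNIV) UNIV = infsum (\<lambda>j. infsum (\<lambda>n. \<phi> n j) UNIV) UNIV"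
    by (rule infsum_swap_banach[OF abs_summable_summable])
  have col: "infsum (\<lambda>n. \<phi> n j) UNIV = f j * cnj (terraced_adjoint a g j)" for j
  proof -
    let ?c = "\<lambda>n. if j \<le> n then cnj (a n) * g n else 0"
    have abs: "summable (\<lambda>n. cmod (?c n))"
      by (rule terraced_adjoint_norm_summable[OF a g])
    have \<phi>: "\<phi> n j = f j * cnj (?c n)" for n by (simp add: \<phi>_def)
    have "(\<lambda>n. \<phi> n j) sums (f j * cnj (terraced_adjoint a g j))"
      unfolding \<phi> terraced_adjoint_def
      by (intro sums_mult) (simp only: sums_cnj summable_sums[OF summable_norm_cancel[OF abs]])
    moreover have "summable (\<lambda>n. cmod (\<phi> n j))"
      unfolding \<phi> norm_mult complex_mod_cnj by (rule summable_mult[OF abs])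
    ultimately show ?thesis
      by (simp add: suminf_eq_infsum[symmetric] sums_iff)
  qed
  have "ell2_inner (?T f) g = infsum (\<lambda>n. infsum (\<phi> n) UNIV) UNIV"
    unfolding ell2_inner_def row
    by (rule suminf_eq_infsum)
       (simp add: norm_mult ell2_summable_norm_mult[OF terraced_ell2[OF a f] g])
  also have "\<dots> = ell2_inner f (terraced_adjoint a g)"
    unfolding ell2_inner_def swap col
    by (rule suminf_eq_infsum[symmetric])
       (simp add: norm_mult ell2_summable_norm_mult[OF f terraced_adjoint_ell2[OF a g]])
  finally show ?thesis .
qed

section \<open>Estimates for the tangent\<close>

lemma sin_taylor_bound:
  fixes x :: real
  assumes "0 \<le> x"
  shows "\<bar>sin x - (x - x ^ 3 / 6 + x ^ 5 / 120 - x ^ 7 / 5040)\<bar> \<le> x ^ 9 / 362880"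
proof -
  have "{..<9::nat} = {0, 1, 2, 3, 4, 5, 6, 7, 8}" by auto
  then have "(\<Sum>m<9. sin_coeff m * x ^ m) = x - x ^ 3 / 6 + x ^ 5 / 120 - x ^ 7 / 5040"
    by (simp add: sin_coeff_def fact_numeral)
  then show ?thesis
    using Maclaurin_sin_bound[of x 9] assms by (simp add: fact_numeral)
qed

lemma cos_taylor_bound:
  fixes x :: real
  assumes "0 \<le> x"
  shows "\<bar>cos x - (1 - x ^ 2 / 2 + x ^ 4 / 24 - x ^ 6 / 720)\<bar> \<le> x ^ 8 / 40320"
proof -
  obtain t where t: "cos x = (\<Sum>m<8. cos_coeff m * x ^ m) + (cos (t + 1/2 * real 8 * pi) / fact 8) * x ^ 8"
    using Maclaurin_cos_expansion[of x 8] by blast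
  have "{..<8::nat} = {0, 1, 2, 3, 4, 5, 6, 7}" by auto
  then have "(\<Sum>m<8. cos_coeff m * x ^ m) = 1 - x ^ 2 / 2 + x ^ 4 / 24 - x ^ 6 / 720"
    by (simp add: cos_coeff_def fact_numeral)
  moreover have "\<bar>(cos (t + 1/2 * real 8 * pi) / fact 8) * x ^ 8\<bar> \<le> x ^ 8 / 40320"
  proof -
    have "\<bar>cos (t + 1/2 * real 8 * pi)\<bar> * x ^ 8 \<le> 1 * x ^ 8"
      by (intro mult_right_mono abs_cos_le_one) (use assms in simp)
    moreover have "\<bar>(cos (t + 1/2 * real 8 * pi) / fact 8) * x ^ 8\<bar>
        = \<bar>cos (t + 1/2 * real 8 * pi)\<bar> * x ^ 8 / 40320"
      by (simp only: abs_mult abs_divide) (use assms in \<open>simp add: fact_numeral\<close>)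
    ultimately show ?thesis by linarith
  qed
  ultimately show ?thesis using t by linarith
qed

text \<open>
  An enclosure of the tangent is verified without division, as \<open>l cos x \<le> sin x \<le> u cos x\<close>, where
  sine and cosine are replaced by the unfavourable ends of their Taylor intervals.
\<close>

lemma tan_between:
  fixes x l u :: real
  assumes x: "0 \<le> x" "x \<le> 1" and "0 \<le> l" "0 \<le> u"
    and l: "l * (1 - x ^ 2 / 2 + x ^ 4 / 24 - x ^ 6 / 720 + x ^ 8 / 40320)
      \<le> x - x ^ 3 / 6 + x ^ 5 / 120 - x ^ 7 / 5040 - x ^ 9 / 362880"
    and u: "x - x ^ 3 / 6 + x ^ 5 / 120 - x ^ 7 / 5040 + x ^ 9 / 362880
      \<le> u * (1 - x ^ 2 / 2 + x ^ 4 / 24 - x ^ 6 / 720 - x ^ 8 / 40320)"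
  shows "l \<le> tan x" and "tan x \<le> u"
proof -
  have pos: "0 < cos x"
    using x pi_gt3 by (intro cos_gt_zero_pi) auto
  have "l * cos x \<le> l * (1 - x ^ 2 / 2 + x ^ 4 / 24 - x ^ 6 / 720 + x ^ 8 / 40320)"
    by (rule mult_left_mono) (use cos_taylor_bound[OF x(1)] assms in linarith)+
  with l have "l * cos x \<le> sin x"
    using sin_taylor_bound[OF x(1)] by linarith
  then show "l \<le> tan x" using pos by (simp add: tan_def field_simps)
  have "u * (1 - x ^ 2 / 2 + x ^ 4 / 24 - x ^ 6 / 720 - x ^ 8 / 40320) \<le> u * cos x"
    by (rule mult_left_mono) (use cos_taylor_bound[OF x(1)] assms in linarith)+
  with u have "sin x \<le> u * cos x"
    using sin_taylor_bound[OF x(1)] by linarith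
  then show "tan x \<le> u" using pos by (simp add: tan_def field_simps)
qed

text \<open>
  The intervals have width \<open>1/2000\<close> except at 1, where the Taylor error of the cosine calls for
  twice that width.
\<close>

lemma tan_enclosures:
  shows "3114/2000 \<le> tan (1::real)" "tan (1::real) \<le> 3116/2000"
    and "1092/2000 \<le> tan (1/2::real)" "tan (1/2::real) \<le> 1093/2000"
    and "692/2000 \<le> tan (1/3::real)" "tan (1/3::real) \<le> 693/2000"
    and "510/2000 \<le> tan (1/4::real)" "tan (1/4::real) \<le> 511/2000"
    and "405/2000 \<le> tan (1/5::real)" "tan (1/5::real) \<le> 406/2000"
    and "336/2000 \<le> tan (1/6::real)" "tan (1/6::real) \<le> 337/2000"
    and "287/2000 \<le> tan (1/7::real)" "tan (1/7::real) \<le> 288/2000"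
  by (rule tan_between[of 1 "3114/2000" "3116/2000"]
        tan_between[of "1/2" "1092/2000" "1093/2000"]
        tan_between[of "1/3" "692/2000" "693/2000"]
        tan_between[of "1/4" "510/2000" "511/2000"]
        tan_between[of "1/5" "405/2000" "406/2000"]
        tan_between[of "1/6" "336/2000" "337/2000"]
        tan_between[of "1/7" "287/2000" "288/2000"];
      simp add: field_simps)+

lemma tan_le_twice:
  fixes x :: real
  assumes "0 \<le> x" "x \<le> 1"
  shows "tan x \<le> 2 * x"
proof -
  have "x\<^sup>2 \<le> 1" "0 \<le> x ^ 4" "x ^ 6 \<le> x ^ 4" "x ^ 8 \<le> x ^ 4"
    using assms by (auto simp: power_le_one intro!: power_decreasing)
  then have cos: "1 / 2 \<le> cos x"
    using cos_taylor_bound[OF assms(1)] by linarith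
  have "sin x \<le> x" using assms by (simp add: sin_x_le_x)
  moreover have "2 * x * (1 / 2) \<le> 2 * x * cos x"
    using cos assms by (intro mult_left_mono) auto
  ultimately have "sin x \<le> 2 * x * cos x" by simp
  then show ?thesis using cos by (simp add: tan_def field_simps)
qed

text \<open>
  With \<open>s = sin\<^sup>2 (1/m) \<le> 1/m\<^sup>2\<close>, the squared tangent is \<open>s / (1 - s)\<close>, which increases with \<open>s\<close> and
  equals \<open>1/(m\<^sup>2 - 1)\<close> at \<open>s = 1/m\<^sup>2\<close>. The bound is stated in partial fractions for telescoping.
\<close>

lemma tan_inverse_square_le:
  fixes m :: real
  assumes "1 < m"
  shows "(tan (1 / m))\<^sup>2 \<le> (1 / (m - 1) - 1 / (m + 1)) / 2"
proof -
  define s where "s = (sin (1 / m))\<^sup>2"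
  have "\<bar>sin (1 / m)\<bar> \<le> 1 / m"
    using abs_sin_x_le_abs_x[of "1 / m"] assms by simp
  then have "s \<le> (1 / m)\<^sup>2"
    unfolding s_def using power_mono[of "\<bar>sin (1 / m)\<bar>" "1 / m" 2] by simp
  then have s: "s * m\<^sup>2 \<le> 1"
    using assms by (simp add: field_simps power2_eq_square)
  have m: "1 < m\<^sup>2" using assms by (simp add: one_less_power)
  have s1: "s < 1"
  proof (rule ccontr)
    assume "\<not> s < 1"
    then have "1 * m\<^sup>2 \<le> s * m\<^sup>2" by (intro mult_right_mono) auto
    with s m show False by simp
  qed
  have "(tan (1 / m))\<^sup>2 = s / (1 - s)"
    by (simp add: tan_def s_def power_divide cos_squared_eq)
  also have "\<dots> \<le> 1 / (m\<^sup>2 - 1)"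
    using s s1 m by (simp add: field_simps)
  also have "\<dots> = (1 / (m - 1) - 1 / (m + 1)) / 2"
    using assms m by (simp add: field_simps power2_eq_square)
  finally show ?thesis .
qed

lemma tan_inverse_square_tail:
  assumes "0 < k"
  shows "summable (\<lambda>n. (tan (1 / (real (n + k) + 1)))\<^sup>2)"
    and "(\<Sum>n. (tan (1 / (real (n + k) + 1)))\<^sup>2) \<le> (1 / real k + 1 / (real k + 1)) / 2"
proof -
  \<comment> \<open>The gap in \<open>1/(m - 1) - 1/(m + 1)\<close> is two steps, so the telescoping sequence has two terms.\<close>
  define c where "c n = (1 / real (n + k) + 1 / (real (n + k) + 1)) / 2" for n
  have "c \<longlonglongrightarrow> 0"
    using tendsto_divide[OF tendsto_add[OF LIMSEQ_ignore_initial_segment[OF lim_1_over_n, of k]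
        LIMSEQ_ignore_initial_segment[OF lim_1_over_n, of "Suc k"]] tendsto_const[of 2]]
    by (simp add: c_def[abs_def] add_ac)
  then have tele: "(\<lambda>n. c n - c (Suc n)) sums (c 0)"
    using telescope_sums'[of c 0] by simp
  have le: "(tan (1 / (real (n + k) + 1)))\<^sup>2 \<le> c n - c (Suc n)" for n
  proof -
    have "c n - c (Suc n) = (1 / real (n + k) - 1 / (real (n + k) + 2)) / 2"
      by (simp add: c_def diff_divide_distrib add_divide_distrib add_ac)
    then show ?thesis
      using tan_inverse_square_le[of "real (n + k) + 1"] assms by (simp add: add_ac)
  qed
  show summable: "summable (\<lambda>n. (tan (1 / (real (n + k) + 1)))\<^sup>2)"
    by (rule summable_comparison_test'[OF sums_summable[OF tele]]) (use le in simp)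
  have "(\<Sum>n. (tan (1 / (real (n + k) + 1)))\<^sup>2) \<le> c 0"
    using suminf_le[OF le summable sums_summable[OF tele]] tele by (simp add: sums_iff)
  then show "(\<Sum>n. (tan (1 / (real (n + k) + 1)))\<^sup>2) \<le> (1 / real k + 1 / (real k + 1)) / 2"
    by (simp add: c_def)
qed

section \<open>The test vector\<close>

definition test_vector :: "nat \<Rightarrow> real" where
  "test_vector n = (if n < 7 then [1, 1, 1, 0, 1, 1, 4] ! n else 0)"

lemma lessThan_7: "{..<7::nat} = {0, 1, 2, 3, 4, 5, 6}"
  by auto

lemma test_vector_total:
  assumes "6 \<le> n"
  shows "(\<Sum>j\<le>n. test_vector j) = 9"
proof -
  have "(\<Sum>j\<le>n. test_vector j) = (\<Sum>j<7. test_vector j)"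
    by (rule sum.mono_neutral_right) (use assms in \<open>auto simp: test_vector_def\<close>)
  then show ?thesis by (simp add: lessThan_7 test_vector_def)
qed

text \<open>
  The left-hand side is the squared norm of the image of the test vector under the operator, the
  right-hand side that under its adjoint. The entries of the test vector and its partial sums
  \<open>1, 2, 3, 3, 4, 5, 9, 9, \<dots>\<close> are nonnegative, so upper bounds for the tangents go into the left-hand
  side and lower bounds into the right-hand side. The resulting rational numbers are about 19.187
  and 19.218.
\<close>

lemma test_vector_norm_less_adjoint_norm:
  fixes t :: "nat \<Rightarrow> real"
  defines "t \<equiv> \<lambda>n. tan (1 / (real n + 1))"
  shows "(\<Sum>n. (t n * (\<Sum>j\<le>n. test_vector j))\<^sup>2)
    < (\<Sum>j<7. (\<Sum>n<7. if j \<le> n then t n * test_vector n else 0)\<^sup>2)"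
proof -
  have lower: "3114/2000 \<le> t 0" "1092/2000 \<le> t 1" "692/2000 \<le> t 2" "510/2000 \<le> t 3"
      "405/2000 \<le> t 4" "336/2000 \<le> t 5" "287/2000 \<le> t 6"
    and upper: "t 0 \<le> 3116/2000" "t 1 \<le> 1093/2000" "t 2 \<le> 693/2000" "t 3 \<le> 511/2000"
      "t 4 \<le> 406/2000" "t 5 \<le> 337/2000" "t 6 \<le> 288/2000"
    using tan_enclosures by (simp_all add: t_def)
  have nonneg: "0 \<le> t 0" "0 \<le> t 1" "0 \<le> t 2" "0 \<le> t 3" "0 \<le> t 4" "0 \<le> t 5" "0 \<le> t 6"
    using lower by linarith+
  have head: "(\<Sum>n<7. (t n * (\<Sum>j\<le>n. test_vector j))\<^sup>2)
      \<le> (3116/2000)\<^sup>2 + (2 * (1093/2000))\<^sup>2 + (3 * (693/2000))\<^sup>2 + (3 * (511/2000))\<^sup>2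
        + (4 * (406/2000))\<^sup>2 + (5 * (337/2000))\<^sup>2 + (9 * (288/2000))\<^sup>2"
  proof -
    have "(\<Sum>n<7. (t n * (\<Sum>j\<le>n. test_vector j))\<^sup>2)
      = (t 0)\<^sup>2 + (2 * t 1)\<^sup>2 + (3 * t 2)\<^sup>2 + (3 * t 3)\<^sup>2 + (4 * t 4)\<^sup>2 + (5 * t 5)\<^sup>2 + (9 * t 6)\<^sup>2"
      by (simp add: lessThan_7 test_vector_def eval_nat_numeral atMost_Suc algebra_simps)
    also have "\<dots> \<le> (3116/2000)\<^sup>2 + (2 * (1093/2000))\<^sup>2 + (3 * (693/2000))\<^sup>2 + (3 * (511/2000))\<^sup>2
        + (4 * (406/2000))\<^sup>2 + (5 * (337/2000))\<^sup>2 + (9 * (288/2000))\<^sup>2"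
      by (intro add_mono power_mono mult_left_mono mult_nonneg_nonneg upper nonneg) auto
    finally show ?thesis .
  qed
  \<comment> \<open>From row 6 on the partial sums are constantly 9.\<close>
  have tail_eq: "(t (n + 7) * (\<Sum>j\<le>n + 7. test_vector j))\<^sup>2 = 81 * (tan (1 / (real (n + 7) + 1)))\<^sup>2" for n
    by (simp add: test_vector_total t_def power_mult_distrib)
  have tan_summable: "summable (\<lambda>n. (tan (1 / (real (n + 7) + 1)))\<^sup>2)"
    by (rule tan_inverse_square_tail) simp
  have summable: "summable (\<lambda>n. (t n * (\<Sum>j\<le>n. test_vector j))\<^sup>2)"
    by (rule iffD1[OF summable_iff_shift[of _ 7]]) (simp only: tail_eq summable_mult[OF tan_summable])
  have "(\<Sum>n. (tan (1 / (real (n + 7) + 1)))\<^sup>2) \<le> (1 / 7 + 1 / 8) / 2"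
    using tan_inverse_square_tail(2)[of 7] by simp
  then have tail: "(\<Sum>n. (t (n + 7) * (\<Sum>j\<le>n + 7. test_vector j))\<^sup>2) \<le> 81 * ((1 / 7 + 1 / 8) / 2)"
    unfolding tail_eq suminf_mult[OF tan_summable] by (intro mult_left_mono) simp_all
  have "(\<Sum>n. (t n * (\<Sum>j\<le>n. test_vector j))\<^sup>2)
      = (\<Sum>n. (t (n + 7) * (\<Sum>j\<le>n + 7. test_vector j))\<^sup>2) + (\<Sum>n<7. (t n * (\<Sum>j\<le>n. test_vector j))\<^sup>2)"
    by (rule suminf_split_initial_segment[OF summable])
  also have "\<dots> \<le> 81 * ((1/7 + 1/8) / 2) + ((3116/2000)\<^sup>2 + (2 * (1093/2000))\<^sup>2 + (3 * (693/2000))\<^sup>2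
      + (3 * (511/2000))\<^sup>2 + (4 * (406/2000))\<^sup>2 + (5 * (337/2000))\<^sup>2 + (9 * (288/2000))\<^sup>2)"
    by (rule add_mono[OF tail head])
  also have "\<dots> < (3114/2000 + 1092/2000 + 692/2000 + 405/2000 + 336/2000 + 4 * (287/2000))\<^sup>2
      + (1092/2000 + 692/2000 + 405/2000 + 336/2000 + 4 * (287/2000))\<^sup>2
      + (692/2000 + 405/2000 + 336/2000 + 4 * (287/2000))\<^sup>2
      + (405/2000 + 336/2000 + 4 * (287/2000))\<^sup>2 + (405/2000 + 336/2000 + 4 * (287/2000))\<^sup>2
      + (336/2000 + 4 * (287/2000))\<^sup>2 + (4 * (287/2000))\<^sup>2"
    by (simp add: power2_eq_square)
  also have "\<dots> \<le> (t 0 + t 1 + t 2 + t 4 + t 5 + 4 * t 6)\<^sup>2 + (t 1 + t 2 + t 4 + t 5 + 4 * t 6)\<^sup>2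
      + (t 2 + t 4 + t 5 + 4 * t 6)\<^sup>2 + (t 4 + t 5 + 4 * t 6)\<^sup>2 + (t 4 + t 5 + 4 * t 6)\<^sup>2
      + (t 5 + 4 * t 6)\<^sup>2 + (4 * t 6)\<^sup>2"
    by (intro add_mono power_mono mult_left_mono lower) auto
  also have "\<dots> = (\<Sum>j<7. (\<Sum>n<7. if j \<le> n then t n * test_vector n else 0)\<^sup>2)"
    by (simp add: lessThan_7 test_vector_def add_ac mult.commute[of 4])
  finally show ?thesis .
qed

theorem proposition2:
  fixes a :: "nat \<Rightarrow> complex"
  assumes "\<And>n. a n = complex_of_real (tan (1 / (real n + 1)))"
  shows "bounded_operator_ell2 (matrix_operator (terraced_matrix a)) \<and>
         \<not> hyponormal_ell2 (matrix_operator (terraced_matrix a))"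
proof
  let ?T = "matrix_operator (terraced_matrix a)"
  let ?v = "\<lambda>n. complex_of_real (test_vector n)"
  have order: "cmod (a n) \<le> 2 / real (Suc n)" for n
  proof -
    have "0 \<le> tan (1 / (real n + 1))"
    proof (rule tan_pos_pi2_le)
      have "1 / (real n + 1) \<le> 1" by simp
      then show "1 / (real n + 1) < pi / 2" using pi_gt3 by linarith
    qed simp
    then show ?thesis
      using tan_le_twice[of "1 / (real n + 1)"] by (simp add: assms add.commute)
  qed
  show "bounded_operator_ell2 ?T"
    by (rule terraced_bounded[OF order])
  show "\<not> hyponormal_ell2 ?T"
  proof
    assume hyp: "hyponormal_ell2 ?T"
    have v: "?v \<in> ell2"
      by (rule ell2_finite_support[of 7]) (simp add: test_vector_def)
    let ?s = "\<lambda>j. \<Sum>n<7. if j \<le> n then tan (1 / (real n + 1)) * test_vector n else 0"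
    have adj: "terraced_adjoint a ?v j = complex_of_real (?s j)" for j
    proof -
      have "terraced_adjoint a ?v j = (\<Sum>n<7. if j \<le> n then cnj (a n) * ?v n else 0)"
        unfolding terraced_adjoint_def by (rule suminf_finite) (auto simp: test_vector_def)
      then show ?thesis
        by (simp add: assms if_distrib cong: if_cong)
    qed
    have "(\<Sum>j<7. (?s j)\<^sup>2) = (\<Sum>j<7. (cmod (terraced_adjoint a ?v j))\<^sup>2)"
      by (simp only: adj norm_of_real power2_abs)
    also have "\<dots> \<le> (\<Sum>j. (cmod (terraced_adjoint a ?v j))\<^sup>2)"
      using terraced_adjoint_ell2[OF order v] unfolding ell2_def by (intro sum_le_suminf) auto
    also have "\<dots> \<le> (\<Sum>n. (cmod (?T ?v n))\<^sup>2)"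
      by (rule hyponormal_imp_adjoint_norm_le[OF hyp terraced_adjoint_ell2[OF order]
            terraced_adjoint_inner[OF order] v])
    also have "\<dots> = (\<Sum>n. (tan (1 / (real n + 1)) * (\<Sum>j\<le>n. test_vector j))\<^sup>2)"
      by (simp only: matrix_operator_terraced assms flip: of_real_sum of_real_mult)
         (simp only: norm_of_real power2_abs)
    finally show False
      using test_vector_norm_less_adjoint_norm by simp
  qed
qed

end
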